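(* Let $\mathbb{G}$ be a finite graph, and let $(A,\mathbb{G})$ be a GIRS-$c$ matrix and $(B,\mathbb{G})$ a GIRS-$d$ matrix, with the same block sizes. Then: (i) $(A^{-1},\mathbb{G})$ is a GIRS-$c$ matrix whenever $A$ is invertible; (ii) $(A+B,\mathbb{G})$ is a GIRS-$(c+d)$ matrix; (iii) $(AB,\mathbb{G})$ is a GIRS-$(c+d)$ matrix.
   Context: A graph-partitioned matrix $(A,\mathbb{G})$ consists of a finite undirected graph $\mathbb{G}$ with vertex set $\{1,\ldots,n\}$, block sizes $N_1,\ldots,N_n$, and a matrix $A\in\mathbb{R}^{N\times N}$, $N=N_1+\cdots+N_n$, partitioned into blocks $A_{ij}\in\mathbb{R}^{N_i\times N_j}$. For an induced subgraph $\mathbb{H}$ of $\mathbb{G}$, let $\overline{\mathbb{H}}$ be the induced subgraph on the complementary vertex set, let $A_{\overline{\mathbb{H}},\mathbb{H}}$ be the submatrix formed by the blocks $A_{ij}$ with $i$ a vertex of $\overline{\mathbb{H}}$ and $j$ a vertex of $\mathbb{H}$, and let $\rho(\mathbb{H})$ be the number of edges of $\mathbb{G}$ joining a vertex of $\mathbb{H}$ to a vertex of $\overline{\mathbb{H}}$. For a constant $c>0$, $(A,\mathbb{G})$ is a GIRS-$c$ matrix (graph-induced rank structure) if $\operatorname{rank}(A_{\overline{\mathbb{H}},\mathbb{H}})\le c\,\rho(\mathbb{H})$ for all induced subgraphs $\mathbb{H}$ of $\mathbb{G}$. *)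

theory Defs
  imports
    "Jordan_Normal_Form.DL_Rank"
    "Jordan_Normal_Form.DL_Submatrix"
    "Jordan_Normal_Form.Gauss_Jordan_Elimination"
begin

text \<open>
  An undirected graph on the vertex set \<open>{1..n}\<close> is given by its set of edges, an edge being the
  unordered pair \<open>{u, v}\<close> of its ends. Loops (\<open>u = v\<close>) are permitted; they never join a vertex set
  to its complement.
\<close>

definition undirected_graph :: "nat \<Rightarrow> nat set set \<Rightarrow> bool" where
  "undirected_graph n E \<longleftrightarrow> E \<subseteq> {{u, v} | u v. u \<in> {1..n} \<and> v \<in> {1..n}}"

text \<open>
  An induced subgraph is determined by its vertex set, so below \<open>H \<subseteq> {1..n}\<close> stands for the
  subgraph induced on \<open>H\<close>, and \<open>{1..n} - H\<close> for its complementary induced subgraph.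
\<close>

definition rho :: "nat \<Rightarrow> nat set set \<Rightarrow> nat set \<Rightarrow> nat" where
  "rho n E H = card {e \<in> E. \<exists>u \<in> H. \<exists>v \<in> {1..n} - H. e = {u, v}}"

text \<open>
  Block sizes are \<open>N 1, \<dots>, N n\<close>. Matrix entries are indexed from 0, so block \<open>i\<close> occupies
  the \<open>N i\<close> indices starting at \<open>N 1 + \<dots> + N (i - 1)\<close>.
\<close>

definition block_indices :: "(nat \<Rightarrow> nat) \<Rightarrow> nat \<Rightarrow> nat set" where
  "block_indices N i = {(\<Sum>k = 1..<i. N k) ..< (\<Sum>k = 1..<i. N k) + N i}"

definition block_submatrix :: "(nat \<Rightarrow> nat) \<Rightarrow> real mat \<Rightarrow> nat set \<Rightarrow> nat set \<Rightarrow> real mat" where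
  "block_submatrix N A S T =
     submatrix A (\<Union>i \<in> S. block_indices N i) (\<Union>j \<in> T. block_indices N j)"

definition graph_partitioned_matrix ::
    "nat \<Rightarrow> nat set set \<Rightarrow> (nat \<Rightarrow> nat) \<Rightarrow> real mat \<Rightarrow> bool" where
  "graph_partitioned_matrix n E N A \<longleftrightarrow>
     undirected_graph n E \<and> A \<in> carrier_mat (\<Sum>i = 1..n. N i) (\<Sum>i = 1..n. N i)"

text \<open>
  The library constant \<open>vec_space.rank\<close> takes the number of rows as its first argument.
\<close>

definition mat_rank :: "real mat \<Rightarrow> nat" where
  "mat_rank M = vec_space.rank (dim_row M) M"

definition GIRS ::
    "real \<Rightarrow> nat \<Rightarrow> nat set set \<Rightarrow> (nat \<Rightarrow> nat) \<Rightarrow> real mat \<Rightarrow> bool" where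
  "GIRS c n E N A \<longleftrightarrow>
     graph_partitioned_matrix n E N A \<and>
     (\<forall>H \<subseteq> {1..n}. real (mat_rank (block_submatrix N A ({1..n} - H) H)) \<le> c * real (rho n E H))"

end

(*
  The rank of the off-diagonal block of a sum or product is controlled by subadditivity of the rank:
  with J the complement of I, (AB)_{J,I} = A_{J,I} B_{I,I} + A_{J,J} B_{J,I}. For the inverse the
  point is the nullity theorem: A_{J,I} and (A^{-1})_{J,I} have the same rank. It is proved with
  matrix identities only, since a matrix of rank r factors as U V through dimension r and admits X, Y
  with X M Y = 1_r, while 1_k cannot factor through a dimension smaller than k.
*)

theory Submission
  imports Defs
begin

section \<open>Rank factorizations and the rank of products\<close>

text \<open>A maximal independent set of columns of \<open>A\<close> becomes the matrix
  \<open>U\<close>; \<open>W\<close> holds the coordinates of all columns of \<open>A\<close> in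
  this basis, and the 0-1 matrix \<open>Y\<close> selects the basis columns from \<open>A\<close>.
  Distinctness and independence are recorded because they later yield a left inverse of
  \<open>U\<close> over the reals.\<close>

lemma (in vec_space) rank_column_factorization:
  assumes A: "A \<in> carrier_mat n nc"
  obtains U W Y where "U \<in> carrier_mat n (rank A)" "W \<in> carrier_mat (rank A) nc"
    "Y \<in> carrier_mat nc (rank A)" "A = U * W" "A * Y = U" "distinct (cols U)" "lin_indpt (set (cols U))"
proof -
  let ?C = "set (cols A)"
  have C: "?C \<subseteq> carrier_vec n" using cols_dim A by blast
  obtain S where S: "maximal S (\<lambda>T. T \<subseteq> ?C \<and> lin_indpt T)"
    using maximal_exists[of "(\<lambda>T. T \<subseteq> ?C \<and> lin_indpt T)" "card ?C" "{}"]
    by (meson List.finite_set card_mono empty_iff empty_subsetI finite_lin_indpt2 rev_finite_subset)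
  have SC: "S \<subseteq> ?C" and liS: "lin_indpt S" using S by (auto simp: maximal_def)
  have finS: "finite S" using SC finite_subset by blast
  have Sc: "S \<subseteq> carrier_vec n" using SC C by blast
  have r: "rank A = card S" by (rule rank_card_indpt[OF A S])
  obtain us where us: "set us = S" "distinct us" using finite_distinct_list[OF finS] by blast
  have len: "length us = rank A" using r us distinct_card by metis
  define U where "U = mat_of_cols n us"
  have Uc: "U \<in> carrier_mat n (rank A)" unfolding U_def using len by auto
  have cU: "cols U = us" unfolding U_def using us Sc by auto
  \<comment> \<open>By maximality: a column outside \<open>span S\<close> could be added to
    \<open>S\<close> without losing independence.\<close>
  have span: "col A j \<in> span S" if j: "j < nc" for j
  proof (rule ccontr)
    assume ns: "col A j \<notin> span S"
    have jC: "col A j \<in> ?C" using j A by (auto simp: cols_def)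
    have "lin_indpt (insert (col A j) S)"
      using lin_dep_iff_in_span[of S "col A j"] ns Sc liS jC C span_mem[OF Sc] by auto
    then have "insert (col A j) S = S"
      using S jC SC unfolding maximal_def by blast
    then show False using ns span_mem[OF Sc] by blast
  qed
  have "\<exists>w. w \<in> carrier_vec (rank A) \<and> U *\<^sub>v w = col A j" if j: "j < nc" for j
  proof -
    obtain a where "lincomb a S = col A j"
      using span[OF j] finite_in_span[OF finS, of "col A j"] Sc by auto
    \<comment> \<open>The coefficients \<open>a\<close> are a function on vectors; as the columns of
      \<open>U\<close> are distinct, they can be listed by column position instead.\<close>
    then have "U *\<^sub>v (vec (rank A) (\<lambda>i. a (col U i))) = col A j"
      using mat_mult_eq_lincomb[OF Uc, of a] cU us by auto
    then show ?thesis by (intro exI[of _ "vec (rank A) (\<lambda>i. a (col U i))"]) auto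
  qed
  then obtain w where w: "\<And>j. j < nc \<Longrightarrow> w j \<in> carrier_vec (rank A)"
    "\<And>j. j < nc \<Longrightarrow> U *\<^sub>v w j = col A j" by metis
  define W where "W = mat_of_cols (rank A) (map w [0..<nc])"
  have Wc: "W \<in> carrier_mat (rank A) nc" unfolding W_def by auto
  have "A = U * W"
  proof (rule eq_matI)
    fix i j assume ij: "i < dim_row (U * W)" "j < dim_col (U * W)"
    then have i: "i < n" and j: "j < nc" using Uc Wc by auto
    have "col W j = w j" unfolding W_def using j w(1)[OF j] by (subst col_mat_of_cols) auto
    then have "(U * W) $$ (i,j) = (U *\<^sub>v w j) $ i" using i j Uc Wc by auto
    then show "A $$ (i,j) = (U * W) $$ (i,j)" using w(2)[OF j] i j A by auto
  qed (use A Uc Wc in auto)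
  moreover
  have "\<exists>y. y < nc \<and> col A y = us ! k" if "k < rank A" for k
  proof -
    have "us ! k \<in> ?C" using that len us SC nth_mem[of k us] by auto
    then show ?thesis using A by (auto simp: cols_def)
  qed
  then obtain y where y: "\<And>k. k < rank A \<Longrightarrow> y k < nc" "\<And>k. k < rank A \<Longrightarrow> col A (y k) = us ! k" by metis
  define Y where "Y = mat nc (rank A) (\<lambda>(i,k). if i = y k then 1 else (0::'a))"
  have Yc: "Y \<in> carrier_mat nc (rank A)" unfolding Y_def by auto
  have "A * Y = U"
  proof (rule eq_matI)
    fix i k assume ik: "i < dim_row U" "k < dim_col U"
    then have i: "i < n" and k: "k < rank A" using Uc by auto
    have "col Y k = unit_vec nc (y k)" unfolding Y_def using k by (auto simp: unit_vec_def)
    then have "(A * Y) $$ (i,k) = col A (y k) $ i" using i k A Yc y(1)[OF k] by auto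
    also have "\<dots> = U $$ (i,k)" using y(2)[OF k] i k len unfolding U_def by (simp add: mat_of_cols_index)
    finally show "(A * Y) $$ (i,k) = U $$ (i,k)" .
  qed (use A Uc Yc in auto)
  ultimately show thesis using that[OF Uc Wc Yc] cU us liS by auto
qed

text \<open>Each column of the product is \<open>U\<close> applied to a column of \<open>W\<close>,
  so the column spaces are nested and their dimensions compare.\<close>

lemma (in vec_space) rank_mult_le:
  assumes U: "U \<in> carrier_mat n k" and W: "W \<in> carrier_mat k nc"
  shows "rank (U * W) \<le> rank U"
proof -
  have UW: "U * W \<in> carrier_mat n nc" using U W by auto
  have cU: "set (cols U) \<subseteq> carrier_vec n" using cols_dim U by blast
  have cUW: "set (cols (U * W)) \<subseteq> carrier_vec n" using cols_dim UW by blast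
  have "set (cols (U * W)) \<subseteq> span (set (cols U))"
  proof
    fix x assume "x \<in> set (cols (U * W))"
    then obtain j where j: "j < nc" "x = col (U * W) j" using UW by (auto simp: cols_def)
    then have "x = U *\<^sub>v col W j" using U W by auto
    then show "x \<in> span (set (cols U))"
      using col_space_eq[OF U] U W j unfolding col_space_def by auto
  qed
  then have sub: "span (set (cols (U * W))) \<subseteq> span (set (cols U))"
    using span_is_subset[OF _ span_is_submodule[OF cU]] by auto
  have "VectorSpace.subspace class_ring (span (set (cols (U * W)))) (span_vs (set (cols U)))"
    by (rule nested_subspaces[OF span_is_subspace[OF cU] span_is_subspace[OF cUW] sub])
  then show ?thesis
    unfolding rank_def
    using vectorspace.subspace_dim[OF subspace_is_vs[OF span_is_subspace[OF cU]]]
      fin_dim_span_cols[OF U] fin_dim_span_cols[OF UW] by auto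
qed


lemma mat_rank_mult_left:
  assumes "dim_row B = dim_col A"
  shows "mat_rank (A * B) \<le> mat_rank A"
proof -
  have "A \<in> carrier_mat (dim_row A) (dim_col A)" "B \<in> carrier_mat (dim_col A) (dim_col B)"
    using assms by auto
  from vec_space.rank_mult_le[OF this] show ?thesis unfolding mat_rank_def by simp
qed

lemma mat_rank_le_dim_col: "mat_rank A \<le> dim_col A"
  unfolding mat_rank_def by (rule vec_space.rank_le_nc) auto

lemma mat_rank_one: "mat_rank (1\<^sub>m k) = k"
  using vec_space.det_rank_iff[of "1\<^sub>m k :: real mat" k] unfolding mat_rank_def by auto

text \<open>The rank of \<open>U * V\<close> is at most the number \<open>l\<close> of columns of
  \<open>U\<close>, while the identity has full rank. This is the dimension count that ends the
  proof of the nullity theorem.\<close>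

lemma one_mat_factor_dim:
  fixes U V :: "real mat"
  assumes "U \<in> carrier_mat k l" "V \<in> carrier_mat l k" "U * V = 1\<^sub>m k"
  shows "k \<le> l"
  using mat_rank_mult_left[of V U] mat_rank_le_dim_col[of U] assms
  by (auto simp: mat_rank_one)

text \<open>The left inverse comes from the Gram matrix of a column basis, which is invertible over \<open>\<real>\<close>.\<close>

lemma mat_rank_factorization:
  fixes M :: "real mat"
  assumes M: "M \<in> carrier_mat n m"
  obtains U V X Y where
    "U \<in> carrier_mat n (mat_rank M)" "V \<in> carrier_mat (mat_rank M) m" "M = U * V"
    "X \<in> carrier_mat (mat_rank M) n" "Y \<in> carrier_mat m (mat_rank M)"
    "X * (M * Y) = 1\<^sub>m (mat_rank M)"
proof -
  interpret vec_space "TYPE(real)" n .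
  define r where "r = mat_rank M"
  have r: "rank M = r" unfolding r_def mat_rank_def using M by simp
  obtain U V Y where f: "U \<in> carrier_mat n r" "V \<in> carrier_mat r m"
    "Y \<in> carrier_mat m r" "M = U * V" "M * Y = U" "distinct (cols U)" "lin_indpt (set (cols U))"
    using rank_column_factorization[OF M] unfolding r by metis
  note Uc = f(1)
  define G where "G = U\<^sup>T * U"
  have Gc: "G \<in> carrier_mat r r" unfolding G_def using Uc by auto
  \<comment> \<open>A vector \<open>v\<close> in the kernel of \<open>G\<close> makes the squared
    length of \<open>U v\<close> vanish, so \<open>U v = 0\<close>, against the independence of the
    columns of \<open>U\<close>.\<close>
  have "det G \<noteq> 0"
  proof
    assume "det G = 0"
    then obtain v where v: "v \<in> carrier_vec r" "v \<noteq> 0\<^sub>v r" "G *\<^sub>v v = 0\<^sub>v r"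
      using det_0_iff_vec_prod_zero_field[OF Gc] by auto
    have Uv: "U *\<^sub>v v \<in> carrier_vec n" using Uc v by auto
    have "(U *\<^sub>v v) \<bullet> (U *\<^sub>v v) = (U\<^sup>T *\<^sub>v (U *\<^sub>v v)) \<bullet> v"
      using transpose_vec_mult_scalar[OF Uc v(1) Uv] by simp
    also have "U\<^sup>T *\<^sub>v (U *\<^sub>v v) = G *\<^sub>v v"
      unfolding G_def using Uc v by (simp add: assoc_mult_mat_vec[of _ r n _ r])
    finally have "(U *\<^sub>v v) \<bullet> (U *\<^sub>v v) = 0" using v by simp
    then have "U *\<^sub>v v = 0\<^sub>v n"
      using conjugate_square_eq_0_vec[OF Uv] by simp
    then show False using lin_depI[OF Uc v(1,2) _ f(6)] f(7) by blast
  qed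
  then obtain G' where G': "G' \<in> carrier_mat r r" "G' * G = 1\<^sub>m r"
    using det_non_zero_imp_unit[OF Gc] unfolding Units_def ring_mat_def by auto
  \<comment> \<open>Since \<open>M * Y = U\<close>, the left inverse \<open>G' * U\<^sup>T\<close>
    of \<open>U\<close> is the required \<open>X\<close>.\<close>
  have "(G' * U\<^sup>T) * (M * Y) = G' * (U\<^sup>T * U)"
    unfolding f(5) using G' Uc by (simp add: assoc_mult_mat[of _ r r _ n _ r])
  then have "(G' * U\<^sup>T) * (M * Y) = 1\<^sub>m r" using G' unfolding G_def by simp
  moreover have "G' * U\<^sup>T \<in> carrier_mat r n" using G' Uc by auto
  ultimately show thesis using that f(1-4) unfolding r_def by blast
qed

text \<open>Passing through a rank factorization \<open>B = U * V\<close> gives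
  \<open>(A * U) * V\<close>, whose left factor has only \<open>mat_rank B\<close> columns. This
  avoids any comparison of row rank with column rank.\<close>

lemma mat_rank_mult_right:
  assumes "dim_row B = dim_col A"
  shows "mat_rank (A * B) \<le> mat_rank B"
proof -
  have B: "B \<in> carrier_mat (dim_col A) (dim_col B)" using assms by auto
  obtain U V where UV: "U \<in> carrier_mat (dim_col A) (mat_rank B)"
    "V \<in> carrier_mat (mat_rank B) (dim_col B)" "B = U * V"
    using mat_rank_factorization[OF B] by metis
  have "A * B = (A * U) * V"
    using UV assoc_mult_mat[of A "dim_row A" "dim_col A" U _ V] by auto
  then show ?thesis
    using mat_rank_mult_left[of V "A * U"] mat_rank_le_dim_col[of "A * U"] UV by auto
qed

lemma mat_rank_add:
  assumes "A \<in> carrier_mat n m" "B \<in> carrier_mat n m"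
  shows "mat_rank (A + B) \<le> mat_rank A + mat_rank B"
  using vec_space.rank_subadditive[OF assms] assms unfolding mat_rank_def by simp

section \<open>The nullity theorem for block matrices\<close>

text \<open>A block column operation: the block row (\<open>A\<close>, \<open>C\<close>) is applied
  to the column (\<open>Z\<close>, 0) minus the column (\<open>B\<close>, \<open>D\<close>) times
  \<open>W\<close>.\<close>

lemma block_elimination:
  fixes A B C D W Z :: "'a::comm_ring_1 mat"
  assumes A: "A \<in> carrier_mat a b" and B: "B \<in> carrier_mat b e" and C: "C \<in> carrier_mat a d"
    and D: "D \<in> carrier_mat d e" and W: "W \<in> carrier_mat e c" and Z: "Z \<in> carrier_mat b c"
  shows "A * (Z - B * W) + C * - (D * W) = A * Z - (A * B + C * D) * W"
proof -
  have "A * (Z - B * W) = A * Z - A * B * W"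
    using A B W Z by (simp add: mult_minus_distrib_mat[of _ a b _ c] assoc_mult_mat[of _ a b _ e _ c])
  moreover have "C * - (D * W) = - (C * D * W)"
    using C D W by (simp add: assoc_mult_mat[of _ a d _ e _ c])
  moreover have "(A * B + C * D) * W = A * B * W + C * D * W"
    using A B C D W by (intro add_mult_distrib_mat) auto
  \<comment> \<open>Matrices form a group only for fixed dimensions, so this rearrangement is
    checked entrywise.\<close>
  moreover have "K - L + - M = K - (L + M)"
    if "K \<in> carrier_mat a c" "L \<in> carrier_mat a c" "M \<in> carrier_mat a c" for K L M :: "'a mat"
    using that by (intro eq_matI) auto
  then have "A * Z - A * B * W + - (C * D * W) = A * Z - (A * B * W + C * D * W)"
    by (metis A B C D W Z mult_carrier_mat)
  ultimately show ?thesis by simp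
qed

text \<open>If \<open>R = U V\<close> and \<open>X R' Y = 1\<close> are rank factorizations, the block products below factor the
  identity of size \<open>h + rank R'\<close> through dimension \<open>h + rank R\<close>.\<close>

lemma mat_rank_complementary_block_le:
  fixes P R P' Q' R' S' :: "real mat"
  assumes P: "P \<in> carrier_mat h h" and R: "R \<in> carrier_mat k h"
    and P': "P' \<in> carrier_mat h h" and Q': "Q' \<in> carrier_mat h k"
    and R': "R' \<in> carrier_mat k h" and S': "S' \<in> carrier_mat k k"
    and one: "P' * P + Q' * R = 1\<^sub>m h" and zero: "R' * P + S' * R = 0\<^sub>m k h"
  shows "mat_rank R' \<le> mat_rank R"
proof -
  define r r' where "r = mat_rank R" and "r' = mat_rank R'"
  obtain U V where U: "U \<in> carrier_mat k r" and V: "V \<in> carrier_mat r h" and RUV: "R = U * V"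
    using mat_rank_factorization[OF R] unfolding r_def by metis
  obtain X Y where X: "X \<in> carrier_mat r' k" and Y: "Y \<in> carrier_mat h r'"
    and XRY: "X * (R' * Y) = 1\<^sub>m r'"
    using mat_rank_factorization[OF R'] unfolding r'_def by metis
  \<comment> \<open>The left factor of the identity will be the block matrix of \<open>P'\<close>,
    \<open>Q'\<close>, \<open>R'\<close>, \<open>S'\<close> with its lower row multiplied by
    \<open>X\<close> and its right column by \<open>U\<close>. It sends (\<open>P\<close>,
    \<open>V\<close>) to (1, 0) and (\<open>Y\<close>, 0) to (\<open>P' * Y\<close>, 1). Subtracting
    the first column times \<open>W\<close> from the second clears the upper entry exactly when
    \<open>W = P' * Y\<close>.\<close>
  define W where "W = P' * Y"
  have W: "W \<in> carrier_mat h r'" unfolding W_def using P' Y by auto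
  have QUV: "Q' * U * V = Q' * R" using RUV Q' U V by auto
  have SUV: "X * (S' * U) * V = X * (S' * R)" 
    using RUV S' U V X by (simp add: assoc_mult_mat[of _ r' k _ r _ h] assoc_mult_mat[of _ k k _ r _ h])
  have tl: "P' * P + Q' * U * V = 1\<^sub>m h" unfolding QUV by (rule one)
  have bl: "X * R' * P + X * (S' * U) * V = 0\<^sub>m r' h"
  proof -
    have "X * R' * P + X * (S' * U) * V = X * (R' * P + S' * R)"
      unfolding SUV using X R' S' P R by (simp add: mult_add_distrib_mat[of _ r' k _ h])
    then show ?thesis using zero X by simp
  qed
  have tr: "P' * (Y - P * W) + Q' * U * - (V * W) = 0\<^sub>m h r'"
  proof -
    have "P' * (Y - P * W) + Q' * U * - (V * W) = P' * Y - (P' * P + Q' * U * V) * W"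
      by (rule block_elimination) (use P' P Y W Q' U V in auto)
    then show ?thesis unfolding tl using W by (simp flip: W_def)
  qed
  have br: "X * R' * (Y - P * W) + X * (S' * U) * - (V * W) = 1\<^sub>m r'"
  proof -
    have "X * R' * (Y - P * W) + X * (S' * U) * - (V * W)
      = X * R' * Y - (X * R' * P + X * (S' * U) * V) * W"
      by (rule block_elimination) (use P' P Y W S' R' X U V in auto)
    moreover have "X * R' * Y = 1\<^sub>m r'" using XRY X R' Y by (simp add: assoc_mult_mat[of _ r' k _ h _ r'])
    moreover have "1\<^sub>m r' - 0\<^sub>m r' r' = (1\<^sub>m r' :: real mat)" by (intro eq_matI) auto
    ultimately show ?thesis unfolding bl using W by simp
  qed
  have F: "P' \<in> carrier_mat h h" "Q' * U \<in> carrier_mat h r"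
    "X * R' \<in> carrier_mat r' h" "X * (S' * U) \<in> carrier_mat r' r"
    using P' Q' R' S' U X by auto
  have K: "P \<in> carrier_mat h h" "Y - P * W \<in> carrier_mat h r'"
    "V \<in> carrier_mat r h" "- (V * W) \<in> carrier_mat r r'"
    using P V W Y by auto
  have "four_block_mat P' (Q' * U) (X * R') (X * (S' * U))
      * four_block_mat P (Y - P * W) V (- (V * W)) = 1\<^sub>m (h + r')"
    unfolding mult_four_block_mat[OF F K] tl tr bl br by simp
  then have "h + r' \<le> h + r"
    by (rule one_mat_factor_dim[OF four_block_carrier_mat[OF F(1,4)] four_block_carrier_mat[OF K(1,4)]])
  then show ?thesis unfolding r_def r'_def by simp
qed

section \<open>Submatrices on complementary index sets\<close>

text \<open>\<open>pick I\<close> enumerates \<open>I\<close> in increasing order. The bijection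
  converts sums over positions in a submatrix into sums over the original indices.\<close>

lemma pick_bij_betw:
  assumes "finite I" shows "bij_betw (pick I) {0..<card I} I"
proof (rule bij_betw_imageI)
  show inj: "inj_on (pick I) {0..<card I}"
    by (rule linorder_inj_onI') (use pick_mono_le in fastforce)
  have "pick I ` {0..<card I} \<subseteq> I" using pick_in_set_le by auto
  then show "pick I ` {0..<card I} = I"
    using card_image[OF inj] assms by (intro card_subset_eq) auto
qed

lemma submatrix_carrier:
  assumes "A \<in> carrier_mat m l" "I \<subseteq> {0..<m}" "J \<subseteq> {0..<l}"
  shows "submatrix A I J \<in> carrier_mat (card I) (card J)"
proof -
  have "{i. i < m \<and> i \<in> I} = I" "{j. j < l \<and> j \<in> J} = J" using assms(2,3) by auto
  then show ?thesis using carrier_matD[OF assms(1)] by (intro carrier_matI) (simp_all add: dim_submatrix)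
qed

lemma submatrix_index_pick:
  assumes "A \<in> carrier_mat m l" "I \<subseteq> {0..<m}" "J \<subseteq> {0..<l}" "i < card I" "j < card J"
  shows "submatrix A I J $$ (i,j) = A $$ (pick I i, pick J j)" "pick I i \<in> I" "pick J j \<in> J"
proof -
  have "{i. i < m \<and> i \<in> I} = I" "{j. j < l \<and> j \<in> J} = J" using assms(2,3) by auto
  then show "submatrix A I J $$ (i,j) = A $$ (pick I i, pick J j)" using assms by (auto simp: submatrix_index)
qed (use assms pick_in_set_le in auto)

lemma submatrix_add:
  assumes A: "A \<in> carrier_mat m l" and B: "B \<in> carrier_mat m l"
    and I: "I \<subseteq> {0..<m}" and J: "J \<subseteq> {0..<l}"
  shows "submatrix (A + B) I J = submatrix A I J + submatrix B I J"
proof (rule eq_matI)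
  note AB = add_carrier_mat[OF B, of A]
  note car = submatrix_carrier[OF A I J] submatrix_carrier[OF B I J] submatrix_carrier[OF AB I J]
  fix i j assume "i < dim_row (submatrix A I J + submatrix B I J)" "j < dim_col (submatrix A I J + submatrix B I J)"
  then have ij: "i < card I" "j < card J" using car by auto
  have "pick I i < m" "pick J j < l" using submatrix_index_pick[OF A I J ij] I J by auto
  then show "submatrix (A + B) I J $$ (i,j) = (submatrix A I J + submatrix B I J) $$ (i,j)"
    using ij car A B by (simp add: submatrix_index_pick[OF A I J ij] submatrix_index_pick[OF B I J ij] submatrix_index_pick[OF AB I J ij])
qed (use A B submatrix_carrier[OF A I J] submatrix_carrier[OF B I J] submatrix_carrier[OF add_carrier_mat[OF B, of A] I J] in auto)

text \<open>The sum over the inner index is split into \<open>L\<close> and its complement. This is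
  block multiplication for index sets that need not be intervals, so no permutation of rows and
  columns has to be introduced.\<close>

lemma submatrix_mult:
  fixes A B :: "'a::comm_semiring_0 mat"
  assumes A: "A \<in> carrier_mat m p" and B: "B \<in> carrier_mat p l"
    and I: "I \<subseteq> {0..<m}" and J: "J \<subseteq> {0..<l}" and L: "L \<subseteq> {0..<p}"
  shows "submatrix (A * B) I J = submatrix A I L * submatrix B L J
    + submatrix A I ({0..<p} - L) * submatrix B ({0..<p} - L) J" (is "_ = ?R")
proof -
  let ?L = "{0..<p} - L"
  have L': "?L \<subseteq> {0..<p}" by auto
  have AB: "A * B \<in> carrier_mat m l" using A B by auto
  have fL: "finite L" "finite ?L" using L finite_subset by auto
  note car = submatrix_carrier[OF AB I J] submatrix_carrier[OF A I L] submatrix_carrier[OF A I L']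
    submatrix_carrier[OF B L J] submatrix_carrier[OF B L' J]
  \<comment> \<open>Indexed by the set \<open>T\<close> itself, the sums for \<open>L\<close> and
    its complement can be joined into one over \<open>{0..<p}\<close>.\<close>
  have part: "(submatrix A I T * submatrix B T J) $$ (i,j) = (\<Sum>t\<in>T. A $$ (pick I i, t) * B $$ (t, pick J j))"
    if T: "T \<subseteq> {0..<p}" and ij: "i < card I" "j < card J" for T i j
  proof -
    note cT = submatrix_carrier[OF A I T] submatrix_carrier[OF B T J]
    have "(submatrix A I T * submatrix B T J) $$ (i,j)
       = (\<Sum>t = 0..<card T. submatrix A I T $$ (i,t) * submatrix B T J $$ (t,j))"
      using ij cT by (auto simp: scalar_prod_def)
    also have "\<dots> = (\<Sum>t = 0..<card T. A $$ (pick I i, pick T t) * B $$ (pick T t, pick J j))"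
      using ij by (intro sum.cong) (auto simp: submatrix_index_pick[OF A I T] submatrix_index_pick[OF B T J])
    also have "\<dots> = (\<Sum>t\<in>T. A $$ (pick I i, t) * B $$ (t, pick J j))"
      using T finite_subset by (intro sum.reindex_bij_betw pick_bij_betw) auto
    finally show ?thesis .
  qed
  show ?thesis
  proof (rule eq_matI)
    fix i j assume "i < dim_row ?R" "j < dim_col ?R"
    then have ij: "i < card I" "j < card J" using car by auto
    have pi: "pick I i < m" "pick J j < l" using submatrix_index_pick[OF AB I J ij] I J by auto
    have "submatrix (A * B) I J $$ (i,j) = (\<Sum>t\<in>{0..<p}. A $$ (pick I i, t) * B $$ (t, pick J j))"
      using pi A B by (simp add: submatrix_index_pick[OF AB I J ij] scalar_prod_def)
    also have "\<dots> = (\<Sum>t\<in>L. A $$ (pick I i, t) * B $$ (t, pick J j))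
      + (\<Sum>t\<in>?L. A $$ (pick I i, t) * B $$ (t, pick J j))"
      using L by (simp add: sum.subset_diff[of L "{0..<p}"] add.commute)
    also have "\<dots> = ?R $$ (i,j)"
      using ij car part[OF L ij] part[OF L' ij] by simp
    finally show "submatrix (A * B) I J $$ (i,j) = ?R $$ (i,j)" .
  qed (use car in auto)
qed


lemma submatrix_one:
  assumes I: "I \<subseteq> {0..<m}"
  shows "submatrix (1\<^sub>m m :: 'a::{zero,one} mat) I I = 1\<^sub>m (card I)"
proof -
  have fin: "finite I" using I finite_subset by auto
  note car = submatrix_carrier[OF one_carrier_mat I I]
  show ?thesis
  proof (rule eq_matI)
    fix i j assume "i < dim_row (1\<^sub>m (card I) :: 'a mat)" "j < dim_col (1\<^sub>m (card I) :: 'a mat)"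
    then have ij: "i < card I" "j < card I" by auto
    note pick = submatrix_index_pick[OF one_carrier_mat I I ij]
    have "pick I i = pick I j \<longleftrightarrow> i = j"
      using bij_betw_imp_inj_on[OF pick_bij_betw[OF fin]] ij by (auto simp: inj_on_def)
    then show "submatrix (1\<^sub>m m :: 'a mat) I I $$ (i,j) = 1\<^sub>m (card I) $$ (i,j)"
      using pick I ij by (auto simp: subset_iff)
  qed (use car in auto)
qed

lemma submatrix_one_disjoint:
  assumes I: "I \<subseteq> {0..<m}" and J: "J \<subseteq> {0..<m}" and "I \<inter> J = {}"
  shows "submatrix (1\<^sub>m m :: 'a::{zero,one} mat) I J = 0\<^sub>m (card I) (card J)"
proof -
  note car = submatrix_carrier[OF one_carrier_mat I J]
  show ?thesis
  proof (rule eq_matI)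
    fix i j assume "i < dim_row (0\<^sub>m (card I) (card J) :: 'a mat)" "j < dim_col (0\<^sub>m (card I) (card J) :: 'a mat)"
    then have ij: "i < card I" "j < card J" by auto
    note pick = submatrix_index_pick[OF one_carrier_mat I J ij]
    have "pick I i \<noteq> pick J j" using pick(2,3) assms(3) by auto
    then show "submatrix (1\<^sub>m m :: 'a mat) I J $$ (i,j) = 0\<^sub>m (card I) (card J) $$ (i,j)"
      using pick I J ij by (auto simp: subset_iff)
  qed (use car in auto)
qed

text \<open>With \<open>J\<close> the complement of \<open>I\<close>, the columns \<open>I\<close>
  of \<open>B * A = 1\<close>, read in the rows \<open>I\<close> and in the rows \<open>J\<close>,
  are the two block equations of the nullity theorem: \<open>P\<close> and \<open>R\<close> are the
  blocks of \<open>A\<close> in columns \<open>I\<close>, and the primed matrices are the four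
  blocks of \<open>B\<close>.\<close>

lemma mat_rank_submatrix_inverse_le:
  fixes A B :: "real mat"
  assumes A: "A \<in> carrier_mat m m" and B: "B \<in> carrier_mat m m" and BA: "B * A = 1\<^sub>m m"
    and I: "I \<subseteq> {0..<m}"
  shows "mat_rank (submatrix B ({0..<m} - I) I) \<le> mat_rank (submatrix A ({0..<m} - I) I)"
proof -
  let ?J = "{0..<m} - I"
  have J: "?J \<subseteq> {0..<m}" and disj: "?J \<inter> I = {}" by auto
  show ?thesis
    by (rule mat_rank_complementary_block_le[OF submatrix_carrier[OF A I I] submatrix_carrier[OF A J I]
        submatrix_carrier[OF B I I] submatrix_carrier[OF B I J] submatrix_carrier[OF B J I]
        submatrix_carrier[OF B J J]])
      (simp_all add: BA submatrix_one[OF I] submatrix_one_disjoint[OF J I disj]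
        flip: submatrix_mult[OF B A I I I] submatrix_mult[OF B A J I I])
qed

text \<open>Splitting the inner index along the same \<open>I\<close> puts an off-diagonal block
  into each summand: that of \<open>A\<close> as left factor of the first, that of \<open>B\<close>
  as right factor of the second.\<close>

lemma mat_rank_submatrix_mult_le:
  fixes A B :: "real mat"
  assumes A: "A \<in> carrier_mat m m" and B: "B \<in> carrier_mat m m" and I: "I \<subseteq> {0..<m}"
  shows "mat_rank (submatrix (A * B) ({0..<m} - I) I)
    \<le> mat_rank (submatrix A ({0..<m} - I) I) + mat_rank (submatrix B ({0..<m} - I) I)"
proof -
  let ?J = "{0..<m} - I"
  have J: "?J \<subseteq> {0..<m}" by auto
  note car = submatrix_carrier[OF A J I] submatrix_carrier[OF B I I]
    submatrix_carrier[OF A J J] submatrix_carrier[OF B J I]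
  have "mat_rank (submatrix (A * B) ?J I) \<le> mat_rank (submatrix A ?J I * submatrix B I I)
      + mat_rank (submatrix A ?J ?J * submatrix B ?J I)"
    unfolding submatrix_mult[OF A B J I I]
    by (rule mat_rank_add[OF mult_carrier_mat[OF car(1,2)] mult_carrier_mat[OF car(3,4)]])
  also have "\<dots> \<le> mat_rank (submatrix A ?J I) + mat_rank (submatrix B ?J I)"
    using car by (intro add_mono mat_rank_mult_left mat_rank_mult_right) auto
  finally show ?thesis .
qed

section \<open>From vertex sets to index sets\<close>

lemma Union_block_indices: "(\<Union>i\<in>{1..n}. block_indices N i) = {0..<\<Sum>i = 1..n. N i}"
proof (induction n)
  case (Suc n)
  have "{1..Suc n} = insert (Suc n) {1..n}" by auto
  then show ?case using Suc by (auto simp: block_indices_def atLeastLessThanSuc_atLeastAtMost)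
qed simp

lemma block_indices_disjoint:
  assumes "1 \<le> i" "i < j" shows "block_indices N i \<inter> block_indices N j = {}"
proof -
  \<comment> \<open>Here \<open>1 \<le> i\<close> matters: the partial sums start at 1, so
    \<open>N 0\<close> is never a summand and could not be absorbed.\<close>
  have "(\<Sum>k = 1..<i. N k) + N i = (\<Sum>k = 1..<Suc i. N k)" using assms by simp
  also have "\<dots> \<le> (\<Sum>k = 1..<j. N k)" using assms by (intro sum_mono2) auto
  finally show ?thesis by (auto simp: block_indices_def)
qed

text \<open>Disjointness of the blocks turns the complement of a vertex set into the complement of
  its index set, the form used in the submatrix lemmas.\<close>

lemma Union_block_indices_Diff:
  assumes "H \<subseteq> {1..n}"
  shows "(\<Union>i\<in>{1..n} - H. block_indices N i)
    = {0..<\<Sum>i = 1..n. N i} - (\<Union>i\<in>H. block_indices N i)"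
proof -
  have "block_indices N i \<inter> block_indices N j = {}" if "i \<in> {1..n} - H" "j \<in> H" for i j
  proof (cases i j rule: linorder_cases)
    case less
    then show ?thesis using block_indices_disjoint[of i j N] that by auto
  next
    case greater
    moreover have "1 \<le> j" using that assms by auto
    ultimately show ?thesis using block_indices_disjoint[of j i N] by auto
  qed (use that in auto)
  then show ?thesis unfolding Union_block_indices[symmetric] using assms by blast
qed

text \<open>The hypothesis on \<open>A\<close> supplies that \<open>E\<close> is a graph on
  \<open>{1..n}\<close>. What remains is a rank bound for complementary index sets, with
  \<open>H\<close> entering through \<open>I\<close> and \<open>rho\<close>.\<close>

lemma GIRS_I:
  assumes "GIRS c n E N A" and "M \<in> carrier_mat (\<Sum>i = 1..n. N i) (\<Sum>i = 1..n. N i)"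
    and "\<And>I H. H \<subseteq> {1..n} \<Longrightarrow> I = (\<Union>i\<in>H. block_indices N i) \<Longrightarrow> I \<subseteq> {0..<\<Sum>i = 1..n. N i} \<Longrightarrow>
      real (mat_rank (submatrix M ({0..<\<Sum>i = 1..n. N i} - I) I)) \<le> e * real (rho n E H)"
  shows "GIRS e n E N M"
  unfolding GIRS_def block_submatrix_def
proof (intro conjI allI impI)
  show "graph_partitioned_matrix n E N M"
    using assms unfolding GIRS_def graph_partitioned_matrix_def by auto
next
  fix H assume H: "H \<subseteq> {1..n}"
  then have "(\<Union>i\<in>H. block_indices N i) \<subseteq> {0..<\<Sum>i = 1..n. N i}"
    unfolding Union_block_indices[symmetric] by blast
  then show "real (mat_rank (submatrix M (\<Union>i\<in>{1..n} - H. block_indices N i)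
      (\<Union>i\<in>H. block_indices N i))) \<le> e * real (rho n E H)"
    unfolding Union_block_indices_Diff[OF H] using assms(3)[OF H refl] by blast
qed

section \<open>Closure under inverse, sum and product\<close>

theorem proposition2p3:
  fixes n :: nat and E :: "nat set set" and N :: "nat \<Rightarrow> nat"
    and A B :: "real mat" and c d :: real
  assumes "c > 0" and "d > 0"
    and "GIRS c n E N A" and "GIRS d n E N B"
  shows "(invertible_mat A \<longrightarrow> GIRS c n E N (the (mat_inverse A)))
       \<and> GIRS (c + d) n E N (A + B)
       \<and> GIRS (c + d) n E N (A * B)"
proof -
  define m where "m = (\<Sum>i = 1..n. N i)"
  have A: "A \<in> carrier_mat m m" and B: "B \<in> carrier_mat m m"
    using assms(3,4) unfolding m_def GIRS_def graph_partitioned_matrix_def by auto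
  \<comment> \<open>The converse of \<open>GIRS_I\<close>: the hypotheses on \<open>A\<close> and
    \<open>B\<close> are read as bounds over index sets.\<close>
  have rank: "real (mat_rank (submatrix M ({0..<m} - I) I)) \<le> e * real (rho n E H)"
    if "GIRS e n E N M" "H \<subseteq> {1..n}" "I = (\<Union>i\<in>H. block_indices N i)" for e M I H
    using that Union_block_indices_Diff[of H n N]
    unfolding GIRS_def block_submatrix_def m_def by auto
  note intro = GIRS_I[OF assms(3), folded m_def]
  have inv: "GIRS c n E N (the (mat_inverse A))" if invA: "invertible_mat A"
  proof -
    obtain C where C: "A * C = 1\<^sub>m m" "C * A = 1\<^sub>m (dim_row C)"
      using invA unfolding invertible_mat_def inverts_mat_def carrier_matD(1)[OF A] by blast
    \<comment> \<open>\<open>invertible_mat\<close> does not state the shape of \<open>C\<close>; it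
      is read off by comparing column numbers in the two equations.\<close>
    have "dim_col C = m" "dim_row C = m"
      using arg_cong[OF C(1), of dim_col] arg_cong[OF C(2), of dim_col] A by auto
    then have "A \<in> Units (ring_mat TYPE(real) m ())"
      using A C unfolding Units_def ring_mat_def by auto
    \<comment> \<open>\<open>mat_inverse\<close> returns \<open>None\<close> only for non-units, so
      \<open>the\<close> is applied to a genuine inverse.\<close>
    then obtain A' where "mat_inverse A = Some A'" 
      using mat_inverse(1)[OF A, of "()"] by (cases "mat_inverse A") auto
    moreover from mat_inverse(2)[OF A this]
    have A': "A' * A = 1\<^sub>m m" "A' \<in> carrier_mat m m" by auto
    moreover have "GIRS c n E N A'"
    proof (rule intro[OF A'(2)])
      fix I H assume H: "H \<subseteq> {1..n}" "I = (\<Union>i\<in>H. block_indices N i)" and I: "I \<subseteq> {0..<m}"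
      show "real (mat_rank (submatrix A' ({0..<m} - I) I)) \<le> c * real (rho n E H)"
        using mat_rank_submatrix_inverse_le[OF A A'(2,1) I] rank[OF assms(3) H] by linarith
    qed
    ultimately show ?thesis by simp
  qed
  have add: "GIRS (c + d) n E N (A + B)"
  proof (rule intro)
    fix I H assume H: "H \<subseteq> {1..n}" "I = (\<Union>i\<in>H. block_indices N i)" and I: "I \<subseteq> {0..<m}"
    have J: "{0..<m} - I \<subseteq> {0..<m}" by auto
    show "real (mat_rank (submatrix (A + B) ({0..<m} - I) I)) \<le> (c + d) * real (rho n E H)"
      using mat_rank_add[OF submatrix_carrier[OF A J I] submatrix_carrier[OF B J I]]
        rank[OF assms(3) H] rank[OF assms(4) H]
      unfolding submatrix_add[OF A B J I] distrib_right by linarith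
  qed (use A B in auto)
  have mult: "GIRS (c + d) n E N (A * B)"
  proof (rule intro)
    fix I H assume H: "H \<subseteq> {1..n}" "I = (\<Union>i\<in>H. block_indices N i)" and I: "I \<subseteq> {0..<m}"
    show "real (mat_rank (submatrix (A * B) ({0..<m} - I) I)) \<le> (c + d) * real (rho n E H)"
      using mat_rank_submatrix_mult_le[OF A B I] rank[OF assms(3) H] rank[OF assms(4) H]
      unfolding distrib_right by linarith
  qed (use A B in auto)
  from inv add mult show ?thesis by blast
qed

end
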